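(* Let $f(x)=\sum_{n\ge 1} a_n x^n$, where $a_n$ is the number of permutations of length $n$ that avoid both $4213$ and $3142$. Then $f$ satisfies \[ x^3f^6+(7x^3-7x^2+2x)f^5+(x^4+14x^3-21x^2+10x-1)f^4+(4x^4+8x^3-19x^2+11x-2)f^3+(6x^4-5x^3-2x^2+2x)f^2+(4x^4-7x^3+4x^2-x)f+x^4-2x^3+x^2=0. \]
   Context: A permutation $\pi$ of length $n$ contains a permutation $\sigma$ of length $k$ if $\pi$ has a subsequence of length $k$ order-isomorphic to $\sigma$; otherwise $\pi$ avoids $\sigma$. The generating function counts nonempty permutations only (no constant term). *)

theory Defs
  imports "HOL-Combinatorics.Multiset_Permutations" "HOL-Computational_Algebra.Formal_Power_Series"
begin

definition order_iso :: "nat list \<Rightarrow> nat list \<Rightarrow> bool" where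
  "order_iso xs ys \<longleftrightarrow> length xs = length ys \<and>
     (\<forall>i < length xs. \<forall>j < length xs. xs ! i < xs ! j \<longleftrightarrow> ys ! i < ys ! j)"

definition contains_pattern :: "nat list \<Rightarrow> nat list \<Rightarrow> bool" where
  "contains_pattern p sigma \<longleftrightarrow> (\<exists>I \<subseteq> {..<length p}. order_iso (nths p I) sigma)"

definition avoids :: "nat list \<Rightarrow> nat list \<Rightarrow> bool" where
  "avoids p sigma \<longleftrightarrow> \<not> contains_pattern p sigma"

definition av_count :: "nat \<Rightarrow> nat" where
  "av_count n = card {p \<in> permutations_of_set {1..n}.
                       avoids p [4,2,1,3] \<and> avoids p [3,1,4,2]}"

definition av_gf :: "int fps" where
  "av_gf = Abs_fps (\<lambda>n. if n = 0 then 0 else int (av_count n))"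

end

theory Submission
  imports Defs "HOL-Library.Sublist"
begin

text \<open>
  Write a nonempty permutation as \<open>L m R\<close> with \<open>m\<close> its maximum. It avoids 4213 and 3142 iff \<open>L\<close>
  does, \<open>R\<close> avoids 213, no value of \<open>R\<close> lies between the two entries of a descent pattern of \<open>L\<close>
  (so \<open>L\<close> is a direct sum of blocks sitting in the value gaps of \<open>R\<close>), and no entry of \<open>L\<close> lies
  between the 3 and the 2 of a 132 pattern of \<open>R\<close>. Let \<open>M\<close> be the class of such pairs \<open>(L, R)\<close> and
  let \<open>u = 1 + f\<close>, so that \<open>f = x M\<close>. Cutting \<open>R\<close> in front of its minimum gives \<open>M = u + T M\<close>,
  where \<open>T\<close> collects the pairs in which \<open>R\<close> starts with its minimum and contains the largest value
  of all. Removing that minimum and the block of \<open>L\<close> below it gives \<open>T = x u Q\<close>, where in \<open>Q\<close>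
  the removed minimum has become the 1 of 132 patterns: now every 21 pattern of \<open>R\<close> blocks the gaps
  between its entries. Finally \<open>Q = 1 + T + u i\<close>, where \<open>i\<close> counts the 213-avoiders that do not start with their minimum: the
  descents of such an \<open>R\<close> cover every inner gap, so \<open>L\<close> must lie below \<open>R\<close>.

  Running the same recursion with \<open>L\<close> forced to be empty gives, for the generating function \<open>c\<close> of
  the 213-avoiders, \<open>c = 1 + x c\<^sup>2\<close> and \<open>i = (1 - x) c - 1\<close>, hence a quadratic equation for \<open>i\<close> over \<open>\<int>[x]\<close>. Eliminating \<open>i\<close> gives the
  sextic for \<open>f\<close>.
\<close>

unbundle fps_syntax

section \<open>Occurrences of short patterns as subsequences\<close>

lemma subseq_Cons_iff:
  "subseq (a # u) (x # Y) \<longleftrightarrow> a = x \<and> subseq u Y \<or> subseq (a # u) Y"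
  by (auto dest: subseq_Cons')

declare subseq_Cons2_iff [simp del]

text \<open>The cases record how many entries of the occurrence fall in \<open>X\<close>. Here and
  for lengths three and four, this turns pattern arguments about concatenations into finite case
  distinctions.\<close>

lemma subseq2_append:
  "subseq [a, b] (X @ Y) \<longleftrightarrow>
     subseq [a, b] X \<or> a \<in> set X \<and> b \<in> set Y \<or> subseq [a, b] Y"
  by (induction X) (auto simp: subseq_Cons_iff subseq_singleton_left dest: subseq_Cons')

lemma subseq3_append:
  "subseq [a, b, c] (X @ Y) \<longleftrightarrow>
     subseq [a, b, c] X \<or> subseq [a, b] X \<and> c \<in> set Y \<or>
     a \<in> set X \<and> subseq [b, c] Y \<or> subseq [a, b, c] Y"
  by (induction X) (auto simp: subseq_Cons_iff subseq_singleton_left subseq2_append dest: subseq_Cons')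

lemma subseq4_append:
  "subseq [a, b, c, d] (X @ Y) \<longleftrightarrow>
     subseq [a, b, c, d] X \<or> subseq [a, b, c] X \<and> d \<in> set Y \<or>
     subseq [a, b] X \<and> subseq [c, d] Y \<or>
     a \<in> set X \<and> subseq [b, c, d] Y \<or> subseq [a, b, c, d] Y"
  by (induction X) (auto simp: subseq_Cons_iff subseq_singleton_left subseq3_append dest: subseq_Cons')

lemmas subseq_split =
  subseq2_append subseq3_append subseq4_append subseq_Cons_iff subseq_singleton_left

lemma subseq_mem: "subseq u X \<Longrightarrow> a \<in> set u \<Longrightarrow> a \<in> set X"
  using list_emb_set[of "(=)" u X a] by auto

lemma subseq_map_iff: "subseq u (map f X) \<longleftrightarrow> (\<exists>v. subseq v X \<and> u = map f v)"
  by (metis nths_map subseq_conv_nths)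

lemma subseq_pair_cases:
  assumes "x \<in> set X" "y \<in> set X" "x \<noteq> y"
  shows "subseq [x, y] X \<or> subseq [y, x] X"
  using assms by (induction X) (auto simp: subseq_split)

lemma subseq_mem2:
  assumes "subseq [a, b] X" shows "a \<in> set X" "b \<in> set X"
  using subseq_mem[OF assms] by auto

lemma subseq_mem3:
  assumes "subseq [a, b, c] X" shows "a \<in> set X" "b \<in> set X" "c \<in> set X"
    "subseq [a, b] X" "subseq [b, c] X" "subseq [a, c] X"
  using subseq_mem[OF assms] subseq_order.trans[OF _ assms] by (auto simp: subseq_Cons_iff)

lemma subseq_mem4:
  assumes "subseq [a, b, c, d] X"
  shows "a \<in> set X" "b \<in> set X" "c \<in> set X" "d \<in> set X"
    "subseq [b, c, d] X" "subseq [a, b, c] X" "subseq [a, b, d] X" "subseq [a, c, d] X"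
  using subseq_mem[OF assms] subseq_order.trans[OF _ assms] by (auto simp: subseq_Cons_iff)

text \<open>No entry above \<open>r\<close> can precede an entry below it. With \<open>r\<close>
  taken from \<open>R\<close>, this is how \<open>separated\<close> cuts \<open>L\<close> into the
  summands of a direct sum.\<close>

lemma split_at_value:
  fixes L :: "nat list"
  assumes "\<And>a b. subseq [a, b] L \<Longrightarrow> \<not> (b < r \<and> r < a)" "r \<notin> set L"
  shows "L = filter (\<lambda>x. x < r) L @ filter (\<lambda>x. r < x) L"
  using assms
proof (induction L)
  case (Cons y L)
  have IH: "L = filter (\<lambda>x. x < r) L @ filter (\<lambda>x. r < x) L"
    by (rule Cons.IH) (use Cons.prems in \<open>auto simp: subseq_split\<close>)
  show ?case
  proof (cases "y < r")
    case False
    then have "r < y" using Cons.prems(2) by auto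
    then have "filter (\<lambda>x. x < r) L = []"
      using Cons.prems(1)[of y] by (auto simp: filter_empty_conv subseq_split)
    with IH \<open>r < y\<close> show ?thesis by auto
  qed (use IH in auto)
qed simp

section \<open>Pairs of lists on a common value set and their generating functions\<close>

type_synonym list_pair_pred = "nat list \<Rightarrow> nat list \<Rightarrow> bool"

text \<open>\<open>S\<close> is not fixed to be an initial segment because the upper part of a
  decomposition lives on \<open>{i..<n}\<close>.\<close>

definition pairs :: "list_pair_pred \<Rightarrow> nat set \<Rightarrow> (nat list \<times> nat list) set" where
  "pairs P S = {(L, R). distinct (L @ R) \<and> set (L @ R) = S \<and> P L R}"

text \<open>Such a \<open>P\<close> sees only the relative order of the entries, so the number of
  pairs depends on \<open>S\<close> only through its size (\<open>card_pairs\<close>).\<close>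

definition order_inv :: "list_pair_pred \<Rightarrow> bool" where
  "order_inv P \<longleftrightarrow> (\<forall>f L R. strict_mono_on (set L \<union> set R) f \<longrightarrow>
     P (map f L) (map f R) = P L R)"

text \<open>Unlike \<open>av_gf\<close>, this keeps the constant term: it is 1 if
  \<open>P [] []\<close> holds and 0 otherwise.\<close>

definition gf :: "list_pair_pred \<Rightarrow> int fps" where
  "gf P = Abs_fps (\<lambda>n. int (card (pairs P {..<n})))"

lemma finite_pairs: assumes "finite S" shows "finite (pairs P S)"
proof (rule finite_subset)
  show "pairs P S \<subseteq> {L. set L \<subseteq> S \<and> distinct L} \<times> {L. set L \<subseteq> S \<and> distinct L}"
    by (auto simp: pairs_def)
  show "finite ({L. set L \<subseteq> S \<and> distinct L} \<times> {L. set L \<subseteq> S \<and> distinct L})"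
    by (intro finite_cartesian_product finite_subset_distinct[OF assms])
qed

text \<open>Relabelling by \<open>f\<close> is injective on pairs. An inequality suffices, since it
  is applied to a bijection and to its inverse.\<close>

lemma card_pairs_le:
  assumes inv: "order_inv P" and f: "strict_mono_on S f" and "f ` S = S'"
    and "finite S"
  shows "card (pairs P S) \<le> card (pairs P S')"
proof (rule card_inj_on_le)
  let ?F = "\<lambda>(L, R). (map f L, map f R)"
  have inj: "inj_on f S" using f by (rule strict_mono_on_imp_inj_on)
  show "inj_on ?F (pairs P S)"
    unfolding inj_on_def pairs_def
    by (auto dest!: map_inj_on intro: inj_on_subset[OF inj])
  show "?F ` pairs P S \<subseteq> pairs P S'"
  proof clarify
    fix L R assume *: "(L, R) \<in> pairs P S"
    then have S: "S = set L \<union> set R" by (auto simp: pairs_def)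
    from * inj have "distinct (map f (L @ R))"
      by (subst distinct_map) (auto simp: pairs_def)
    with * f inv show "(map f L, map f R) \<in> pairs P S'"
      unfolding pairs_def order_inv_def using S \<open>f ` S = S'\<close>
      by (simp only: mem_Collect_eq prod.case) (auto simp: image_Un)
  qed
  show "finite (pairs P S')" using assms by (auto intro: finite_pairs)
qed

lemma card_pairs:
  assumes inv: "order_inv P" and "finite S"
  shows "int (card (pairs P S)) = gf P $ card S"
proof -
  let ?n = "card S"
  \<comment> \<open>The increasing enumeration of \<open>S\<close>; its inverse \<open>?g\<close>
    below gives the opposite inequality.\<close>
  let ?e = "\<lambda>i. sorted_list_of_set S ! i"
  have mono: "strict_mono_on {..<?n} ?e"
    using assms by (intro strict_mono_onI)
      (simp add: sorted_wrt_nth_less[OF strict_sorted_list_of_set])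
  have "?e ` {..<length (sorted_list_of_set S)} = set (sorted_list_of_set S)"
    by (force simp: in_set_conv_nth)
  then have img: "?e ` {..<?n} = S" using assms(2) by simp
  let ?g = "the_inv_into {..<?n} ?e"
  have inj: "inj_on ?e {..<?n}" using mono by (rule strict_mono_on_imp_inj_on)
  have img': "?g ` S = {..<?n}"
    using the_inv_into_onto[OF inj] img by simp
  have mono': "strict_mono_on S ?g"
  proof (rule strict_mono_onI)
    fix x y assume xy: "x \<in> S" "y \<in> S" "x < y"
    then obtain i j where ij: "i < ?n" "j < ?n" "x = ?e i" "y = ?e j"
      using img by (metis (no_types, lifting) imageE lessThan_iff)
    then have "i < j" using xy mono
      by (metis (no_types, lifting) lessThan_iff strict_mono_on_less)
    then show "?g x < ?g y" using ij the_inv_into_f_f[OF inj] by simp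
  qed
  have "card (pairs P S) = card (pairs P {..<?n})"
    using card_pairs_le[OF inv mono img] card_pairs_le[OF inv mono' img'] assms by simp
  then show ?thesis by (simp add: gf_def)
qed

lemma gf_cong:
  assumes "\<And>L R. distinct (L @ R) \<Longrightarrow> P L R = Q L R"
  shows "gf P = gf Q"
proof -
  have "pairs P S = pairs Q S" for S using assms by (auto simp: pairs_def)
  then show ?thesis by (simp add: gf_def)
qed

lemma gf_add:
  assumes "\<And>L R. distinct (L @ R) \<Longrightarrow> P L R = (Q L R \<or> Z L R)"
    and "\<And>L R. distinct (L @ R) \<Longrightarrow> \<not> (Q L R \<and> Z L R)"
  shows "gf P = gf Q + gf Z"
proof (rule fps_ext)
  fix n
  have "pairs P {..<n} = pairs Q {..<n} \<union> pairs Z {..<n}"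
    using assms(1) by (auto simp: pairs_def)
  moreover have "pairs Q {..<n} \<inter> pairs Z {..<n} = {}"
    using assms(2) by (auto simp: pairs_def)
  ultimately show "gf P $ n = (gf Q + gf Z) $ n"
    by (simp add: gf_def card_Un_disjoint finite_pairs)
qed

lemma gf_Nil: "gf (\<lambda>L R. L = [] \<and> R = []) = 1"
proof (rule fps_ext)
  fix n :: nat
  have "pairs (\<lambda>L R. L = [] \<and> R = []) S = (if S = {} then {([], [])} else {})" for S
    by (auto simp: pairs_def)
  then show "gf (\<lambda>L R. L = [] \<and> R = []) $ n = 1 $ n"
    by (simp add: gf_def lessThan_empty_iff bot_nat_def)
qed

text \<open>\<open>F m\<close> inserts a new maximum \<open>m\<close>. The assumptions make it a
  bijection from the pairs on \<open>{..<m}\<close> to those on \<open>{..<Suc m}\<close>, whence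
  the factor \<open>fps_X\<close>; \<open>nonempty\<close> settles the constant term.\<close>

lemma gf_remove_Max:
  assumes inj: "\<And>m L R L' R'. Q L R \<Longrightarrow> Q L' R' \<Longrightarrow> m \<notin> set (L @ R) \<Longrightarrow> m \<notin> set (L' @ R') \<Longrightarrow>
      F m L R = F m L' R' \<Longrightarrow> (L, R) = (L', R')"
    and ins: "\<And>m L R. distinct (L @ R) \<Longrightarrow> Q L R \<Longrightarrow> \<forall>y \<in> set (L @ R). y < m \<Longrightarrow>
      F m L R \<in> pairs P (insert m (set (L @ R)))"
    and rem: "\<And>m L R. distinct (L @ R) \<Longrightarrow> P L R \<Longrightarrow> m \<in> set (L @ R) \<Longrightarrow>
      \<forall>y \<in> set (L @ R). y \<le> m \<Longrightarrow> \<exists>L' R'. Q L' R' \<and> (L, R) = F m L' R' \<and>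
      distinct (L' @ R') \<and> set (L' @ R') = set (L @ R) - {m}"
    and nonempty: "\<not> P [] []"
  shows "gf P = fps_X * gf Q"
proof (rule fps_ext)
  fix n
  show "gf P $ n = (fps_X * gf Q) $ n"
  proof (cases n)
    case 0
    have "pairs P {} = {}" using nonempty by (auto simp: pairs_def)
    with 0 show ?thesis by (simp add: gf_def)
  next
    case (Suc m)
    have "card (pairs Q {..<m}) = card (pairs P {..<Suc m})"
    proof (rule bij_betw_same_card[of "\<lambda>(L, R). F m L R"], rule bij_betw_imageI)
      show "inj_on (\<lambda>(L, R). F m L R) (pairs Q {..<m})"
      proof (rule inj_onI, clarify)
        fix L R L' R' assume "(L, R) \<in> pairs Q {..<m}" "(L', R') \<in> pairs Q {..<m}"
          "F m L R = F m L' R'"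
        then have "(L, R) = (L', R')"
          by (intro inj[of L R L' R' m]) (simp_all add: pairs_def)
        then show "L = L' \<and> R = R'" by simp
      qed
      show "(\<lambda>(L, R). F m L R) ` pairs Q {..<m} = pairs P {..<Suc m}"
      proof (intro equalityI subsetI)
        fix z assume "z \<in> (\<lambda>(L, R). F m L R) ` pairs Q {..<m}"
        then obtain L R where *: "(L, R) \<in> pairs Q {..<m}" and z: "z = F m L R" by auto
        then have S: "set (L @ R) = {..<m}" and d: "distinct (L @ R)" "Q L R"
          by (simp_all add: pairs_def)
        have "F m L R \<in> pairs P (insert m (set (L @ R)))"
          by (rule ins[OF d]) (unfold S, simp)
        then show "z \<in> pairs P {..<Suc m}"
          by (simp only: S lessThan_Suc z)
      next
        fix z assume "z \<in> pairs P {..<Suc m}"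
        then obtain L R where *: "(L, R) \<in> pairs P {..<Suc m}" and z: "z = (L, R)"
          by (metis surj_pair)
        then have S: "set (L @ R) = {..<Suc m}" and d: "distinct (L @ R)" "P L R"
          by (simp_all add: pairs_def)
        have "\<forall>y \<in> set (L @ R). y \<le> m" "m \<in> set (L @ R)" "set (L @ R) - {m} = {..<m}"
          unfolding S by auto
        with rem[OF d] obtain L' R' where *: "Q L' R'" "(L, R) = F m L' R'"
          "distinct (L' @ R')" "set (L' @ R') = {..<m}"
          by metis
        then have "(L', R') \<in> pairs Q {..<m}" unfolding pairs_def
          by (simp only: mem_Collect_eq prod.case simp_thms)
        with *(2) z show "z \<in> (\<lambda>(L, R). F m L R) ` pairs Q {..<m}"
          by (auto intro: rev_image_eqI)
      qed
    qed
    with Suc show ?thesis by (simp add: gf_def)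
  qed
qed

text \<open>
  \<open>s\<close> recovers the set of values of the lower part from the joined pair, which makes the
  decomposition unique.
\<close>
lemma gf_split:
  assumes Q: "order_inv Q" and Z: "order_inv Z"
    and C: "C = (@) \<or> C = (\<lambda>R1 R2. R2 @ R1)"
    and join: "\<And>L1 R1 L2 R2. distinct ((L1 @ R1) @ (L2 @ R2)) \<Longrightarrow> Q L1 R1 \<Longrightarrow> Z L2 R2 \<Longrightarrow>
      \<forall>x \<in> set L1 \<union> set R1. \<forall>y \<in> set L2 \<union> set R2. x < y \<Longrightarrow>
      P (L1 @ L2) (C R1 R2) \<and> s (L1 @ L2) (C R1 R2) = set L1 \<union> set R1"
    and decomp: "\<And>L R. distinct (L @ R) \<Longrightarrow> P L R \<Longrightarrow>
      \<exists>L1 R1 L2 R2. L = L1 @ L2 \<and> R = C R1 R2 \<and> Q L1 R1 \<and> Z L2 R2 \<and>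
        (\<forall>x \<in> set L1 \<union> set R1. \<forall>y \<in> set L2 \<union> set R2. x < y)"
  shows "gf P = gf Q * gf Z"
proof (rule fps_ext)
  fix n
  let ?J = "\<lambda>((L1, R1), (L2, R2)). (L1 @ L2, C R1 R2)"
  let ?A = "\<lambda>i. pairs Q {..<i} \<times> pairs Z {i..<n}"
  have setC: "set (C R1 R2) = set R1 \<union> set R2" for R1 R2
    using C by auto
  have distC: "distinct (C R1 R2) \<longleftrightarrow> distinct (R1 @ R2)" for R1 R2
    using C by auto
  have in_A: "distinct ((L1 @ R1) @ (L2 @ R2)) \<and> Q L1 R1 \<and> Z L2 R2 \<and>
      (\<forall>x \<in> set L1 \<union> set R1. \<forall>y \<in> set L2 \<union> set R2. x < y) \<and>
      set L1 \<union> set R1 = {..<i} \<and> set L2 \<union> set R2 = {i..<n}"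
    if "((L1, R1), (L2, R2)) \<in> ?A i" for i L1 R1 L2 R2
  proof -
    have sets: "set L1 \<union> set R1 = {..<i}" "set L2 \<union> set R2 = {i..<n}"
      using that by (auto simp: pairs_def)
    then have "(set L1 \<union> set R1) \<inter> (set L2 \<union> set R2) = {}" by auto
    with that sets show ?thesis by (auto simp: pairs_def)
  qed
  have s: "s (fst (?J z)) (snd (?J z)) = {..<i}" if "z \<in> ?A i" for z i
  proof -
    obtain L1 R1 L2 R2 where z: "z = ((L1, R1), (L2, R2))" by (metis surj_pair)
    show ?thesis using join in_A[OF that[unfolded z]] unfolding z by auto
  qed
  \<comment> \<open>For a fixed threshold \<open>i\<close> the four parts are recovered from the
    joined pair by filtering at \<open>i\<close>.\<close>
  have inj: "inj_on ?J (?A i)" for i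
  proof (rule inj_onI)
    fix z z' assume z: "z \<in> ?A i" "z' \<in> ?A i" "?J z = ?J z'"
    obtain L1 R1 L2 R2 where z1: "z = ((L1, R1), (L2, R2))" by (metis surj_pair)
    obtain L1' R1' L2' R2' where z2: "z' = ((L1', R1'), (L2', R2'))" by (metis surj_pair)
    have 1: "(L1, R1) \<in> pairs Q {..<i}" "(L2, R2) \<in> pairs Z {i..<n}"
      and 2: "(L1', R1') \<in> pairs Q {..<i}" "(L2', R2') \<in> pairs Z {i..<n}"
      and L: "L1 @ L2 = L1' @ L2'" and R: "C R1 R2 = C R1' R2'"
      using z unfolding z1 z2 by (simp_all del: append_eq_append_conv)
    have f1: "filter (\<lambda>x. x < i) L = L" "filter (\<lambda>x. \<not> x < i) L = []"
      "filter (\<lambda>x. x < i) R = R" "filter (\<lambda>x. \<not> x < i) R = []"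
      if "(L, R) \<in> pairs Q {..<i}" for L R
      using that by (auto simp: pairs_def filter_empty_conv filter_id_conv)
    have f2: "filter (\<lambda>x. \<not> x < i) L = L" "filter (\<lambda>x. x < i) L = []"
      "filter (\<lambda>x. \<not> x < i) R = R" "filter (\<lambda>x. x < i) R = []"
      if "(L, R) \<in> pairs Z {i..<n}" for L R
    proof -
      have "i \<le> x" if "x \<in> set L \<union> set R" for x
        using that \<open>(L, R) \<in> pairs Z {i..<n}\<close> unfolding pairs_def by auto
      then show "filter (\<lambda>x. \<not> x < i) L = L" "filter (\<lambda>x. x < i) L = []"
        "filter (\<lambda>x. \<not> x < i) R = R" "filter (\<lambda>x. x < i) R = []"
        by (auto simp: filter_empty_conv filter_id_conv not_less)
    qed
    note ff = f1[OF 1(1)] f1[OF 2(1)] f2[OF 1(2)] f2[OF 2(2)]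
    have "L1 = L1'" using arg_cong[OF L, of "filter (\<lambda>x. x < i)"]
      by (simp only: filter_append ff append_Nil2)
    moreover have "L2 = L2'" using arg_cong[OF L, of "filter (\<lambda>x. \<not> x < i)"]
      by (simp only: filter_append ff append_Nil)
    moreover have "R1 = R1'" using arg_cong[OF R, of "filter (\<lambda>x. x < i)"] C
      by (auto simp only: filter_append ff append_Nil append_Nil2)
    moreover have "R2 = R2'" using arg_cong[OF R, of "filter (\<lambda>x. \<not> x < i)"] C
      by (auto simp only: filter_append ff append_Nil append_Nil2)
    ultimately show "z = z'" unfolding z1 z2 by simp
  qed
  have "pairs P {..<n} = (\<Union>i\<in>{..n}. ?J ` ?A i)"
  proof (intro equalityI subsetI)
    fix z assume z: "z \<in> pairs P {..<n}"
    then obtain L R where zLR: "z = (L, R)" and d: "distinct (L @ R)" "P L R"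
      and set: "set L \<union> set R = {..<n}" by (auto simp: pairs_def)
    from decomp[OF d] obtain L1 R1 L2 R2 where *: "L = L1 @ L2" "R = C R1 R2" "Q L1 R1"
      "Z L2 R2" "\<forall>x \<in> set L1 \<union> set R1. \<forall>y \<in> set L2 \<union> set R2. x < y" by blast
    let ?S1 = "set L1 \<union> set R1" and ?S2 = "set L2 \<union> set R2"
    have un: "?S1 \<union> ?S2 = {..<n}" using set * setC by auto
    \<comment> \<open>The least strict upper bound of the lower values; an empty lower part gives
      0.\<close>
    define i where "i = (LEAST i. \<forall>x \<in> ?S1. x < i)"
    have ex: "\<forall>x \<in> ?S1. x < n" using un by auto
    have i1: "\<forall>x \<in> ?S1. x < i" unfolding i_def by (rule LeastI[of _ n]) (rule ex)
    have i2: "i \<le> n" unfolding i_def by (rule Least_le) (rule ex)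
    have i3: "\<forall>y \<in> ?S2. i \<le> y" unfolding i_def using *(5) by (intro ballI Least_le) auto
    have bnd: "x < n" if "x \<in> ?S1 \<union> ?S2" for x
      using that unfolding un by simp
    have "x \<in> ?S1 \<longleftrightarrow> x < i" "x \<in> ?S2 \<longleftrightarrow> i \<le> x \<and> x < n" for x
    proof -
      have "x \<in> ?S1 \<union> ?S2" if "x < n" using that unfolding un by simp
      then show "x \<in> ?S1 \<longleftrightarrow> x < i" "x \<in> ?S2 \<longleftrightarrow> i \<le> x \<and> x < n"
        using i1 i2 i3 bnd[of x] by (meson Un_iff not_le order.strict_trans1 order.strict_trans2)+
    qed
    then have "?S1 = {..<i}" "?S2 = {i..<n}"
      by (simp_all only: set_eq_iff lessThan_iff atLeastLessThan_iff simp_thms)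
    moreover have "distinct (L1 @ R1)" "distinct (L2 @ R2)"
      using d(1) unfolding *(1,2) by (auto simp: distC setC)
    ultimately have "((L1, R1), (L2, R2)) \<in> ?A i"
      using *(3,4) unfolding pairs_def set_append
      by (simp only: mem_Sigma_iff mem_Collect_eq prod.case simp_thms)
    then have "z \<in> ?J ` ?A i" unfolding zLR *(1,2) by (rule rev_image_eqI) simp
    then show "z \<in> (\<Union>i\<in>{..n}. ?J ` ?A i)" using i2 by blast
  next
    fix z assume "z \<in> (\<Union>i\<in>{..n}. ?J ` ?A i)"
    then obtain i L1 R1 L2 R2 where i: "i \<le> n" "((L1, R1), (L2, R2)) \<in> ?A i"
      and z: "z = (L1 @ L2, C R1 R2)" by auto
    note A = in_A[OF i(2)]
    have "P (L1 @ L2) (C R1 R2)" using join A by blast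
    moreover have "set ((L1 @ L2) @ C R1 R2) = {..<i} \<union> {i..<n}"
      using A unfolding set_append setC by blast
    moreover have "{..<i} \<union> {i..<n} = {..<n}" using i(1) by auto
    moreover have "distinct ((L1 @ L2) @ C R1 R2)" using A distC setC by auto
    ultimately show "z \<in> pairs P {..<n}" unfolding z pairs_def
      by (simp only: mem_Collect_eq prod.case simp_thms)
  qed
  moreover have "card (\<Union>i\<in>{..n}. ?J ` ?A i) = (\<Sum>i\<in>{..n}. card (?J ` ?A i))"
  proof (rule card_UN_disjoint)
    show "\<forall>i\<in>{..n}. finite (?J ` ?A i)" by (simp add: finite_pairs)
    show "\<forall>i\<in>{..n}. \<forall>j\<in>{..n}. i \<noteq> j \<longrightarrow> ?J ` ?A i \<inter> ?J ` ?A j = {}"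
    proof (intro ballI impI, rule ccontr)
      fix i j assume "i \<noteq> j" "?J ` ?A i \<inter> ?J ` ?A j \<noteq> {}"
      then obtain z z' where z: "z \<in> ?A i" "z' \<in> ?A j" "?J z = ?J z'" by blast
      from s[OF z(1)] s[OF z(2)] have "{..<i} = {..<j}" unfolding z(3) by simp
      with \<open>i \<noteq> j\<close> show False by simp
    qed
  qed simp
  moreover have "card (?J ` ?A i) = card (pairs Q {..<i}) * card (pairs Z {i..<n})" for i
    by (simp add: card_image[OF inj] card_cartesian_product)
  ultimately have "int (card (pairs P {..<n})) =
      (\<Sum>i\<in>{..n}. int (card (pairs Q {..<i})) * int (card (pairs Z {i..<n})))"
    by simp
  \<comment> \<open>The count on \<open>{i..<n}\<close> depends only on the size
    \<open>n - i\<close>, so the sum is a Cauchy product.\<close>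
  also have "\<dots> = (\<Sum>i\<in>{..n}. gf Q $ i * gf Z $ (n - i))"
    using card_pairs[OF Q, of "{..<_}"] card_pairs[OF Z, of "{_..<_}"] by simp
  also have "\<dots> = (gf Q * gf Z) $ n"
    by (simp only: fps_mult_nth atLeast0AtMost)
  finally show "gf P $ n = (gf Q * gf Z) $ n"
    by (simp only: gf_def[of P] fps_nth_Abs_fps)
qed

section \<open>Conditions on the two sides of the maximum, and the classes of pairs\<close>

definition avoids_213 :: "nat list \<Rightarrow> bool" where
  "avoids_213 R \<longleftrightarrow> (\<forall>a b c. subseq [a, b, c] R \<longrightarrow> \<not> (b < a \<and> a < c))"

text \<open>A violation \<open>a, b\<close>, followed by the maximum and then by \<open>r\<close>,
  is an occurrence of 3142.\<close>

definition separated :: list_pair_pred where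
  "separated L R \<longleftrightarrow> (\<forall>a b r. subseq [a, b] L \<and> r \<in> set R \<longrightarrow> \<not> (b < r \<and> r < a))"

text \<open>A violating \<open>l\<close> followed by \<open>b, c, d\<close> is an occurrence of
  3142.\<close>

definition gap_132 :: list_pair_pred where
  "gap_132 L R \<longleftrightarrow> (\<forall>b c d l. subseq [b, c, d] R \<and> l \<in> set L \<longrightarrow> \<not> (b < d \<and> d < l \<and> l < c))"

text \<open>This is what \<open>gap_132\<close> becomes when \<open>R\<close> is preceded by an
  entry smaller than all of its own, which acts as the 1 of the pattern.\<close>

definition gap_21 :: list_pair_pred where
  "gap_21 L R \<longleftrightarrow> (\<forall>c d l. subseq [c, d] R \<and> l \<in> set L \<longrightarrow> \<not> (d < l \<and> l < c))"

text \<open>For nonempty \<open>R\<close> the largest value of the pair lies in \<open>R\<close>;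
  for empty \<open>R\<close> the list \<open>L\<close> is forced to be empty.\<close>

definition dominated :: list_pair_pred where
  "dominated L R \<longleftrightarrow> (\<forall>l \<in> set L. \<exists>r \<in> set R. l < r)"

definition min_first :: "nat list \<Rightarrow> bool" where
  "min_first R \<longleftrightarrow> (\<forall>r \<in> set R. hd R \<le> r)"

text \<open>The class counted by \<open>i\<close>, written as a predicate on pairs with empty left
  list so that \<open>gf\<close> applies to it.\<close>

definition indec_213 :: list_pair_pred where
  "indec_213 L R \<longleftrightarrow> L = [] \<and> R \<noteq> [] \<and> avoids_213 R \<and> \<not> min_first R"

text \<open>
  \<open>K\<close> is the class from which \<open>L\<close> is taken: both the class under study and the class of the empty
  list alone are instances.
\<close>
locale sum_closed =
  fixes K :: "nat list \<Rightarrow> bool"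
  assumes K_Nil: "K []"
    and K_append: "\<And>X Y. \<forall>x \<in> set X. \<forall>y \<in> set Y. x < y \<Longrightarrow> K (X @ Y) \<longleftrightarrow> K X \<and> K Y"
    and K_map: "\<And>f X. strict_mono_on (set X) f \<Longrightarrow> K (map f X) = K X"
begin

definition U :: list_pair_pred where "U L R \<longleftrightarrow> R = [] \<and> K L"
text \<open>The lower part that is cut off from a pair in \<open>T\<close>: the minimum of
  \<open>R\<close> and the block of \<open>L\<close> below it.\<close>

definition U1 :: list_pair_pred where "U1 L R \<longleftrightarrow> K L \<and> (\<exists>r. R = [r] \<and> (\<forall>l \<in> set L. l < r))"
definition M :: list_pair_pred where
  "M L R \<longleftrightarrow> K L \<and> avoids_213 R \<and> separated L R \<and> gap_132 L R"
definition Q :: list_pair_pred where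
  "Q L R \<longleftrightarrow> K L \<and> avoids_213 R \<and> separated L R \<and> gap_21 L R \<and> dominated L R"
definition T :: list_pair_pred where "T L R \<longleftrightarrow> Q L R \<and> R \<noteq> [] \<and> min_first R"

end

section \<open>Invariance under order-preserving relabelling and passage to subsequences\<close>

lemma strict_mono_on_nat_less:
  fixes f :: "nat \<Rightarrow> nat"
  shows "strict_mono_on S f \<Longrightarrow> x \<in> S \<Longrightarrow> y \<in> S \<Longrightarrow> f x < f y \<longleftrightarrow> x < y"
  by (simp add: strict_mono_on_less)

lemma subseq2_map:
  "(\<forall>a b. subseq [a, b] (map f X) \<longrightarrow> P a b) \<longleftrightarrow>
   (\<forall>a b. subseq [a, b] X \<longrightarrow> P (f a) (f b))"
  unfolding subseq_map_iff by (auto simp: Cons_eq_map_conv) fastforce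

lemma subseq3_map:
  "(\<forall>a b c. subseq [a, b, c] (map f X) \<longrightarrow> P a b c) \<longleftrightarrow>
   (\<forall>a b c. subseq [a, b, c] X \<longrightarrow> P (f a) (f b) (f c))"
  unfolding subseq_map_iff by (auto simp: Cons_eq_map_conv) fastforce

lemma subseq4_map:
  "(\<forall>a b c d. subseq [a, b, c, d] (map f X) \<longrightarrow> P a b c d) \<longleftrightarrow>
   (\<forall>a b c d. subseq [a, b, c, d] X \<longrightarrow> P (f a) (f b) (f c) (f d))"
  unfolding subseq_map_iff by (auto simp: Cons_eq_map_conv) fastforce

lemma avoids_213_map:
  assumes "strict_mono_on (set R) f"
  shows "avoids_213 (map f R) = avoids_213 R"
  unfolding avoids_213_def subseq3_map
  by (intro all_cong1 imp_cong refl)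
    (simp add: strict_mono_on_nat_less[OF assms] subseq_mem3)

lemma separated_map:
  assumes "strict_mono_on (set L \<union> set R) f"
  shows "separated (map f L) (map f R) = separated L R"
proof -
  have "separated L R \<longleftrightarrow> (\<forall>a b. subseq [a, b] L \<longrightarrow> (\<forall>r \<in> set R. \<not> (b < r \<and> r < a)))" for L R
    by (auto simp: separated_def)
  then show ?thesis
    by (simp only: subseq2_map set_map ball_simps, intro all_cong1 imp_cong refl ball_cong)
      (simp add: strict_mono_on_nat_less[OF assms] subseq_mem2)
qed

lemma gap_132_map:
  assumes "strict_mono_on (set L \<union> set R) f"
  shows "gap_132 (map f L) (map f R) = gap_132 L R"
proof -
  have "gap_132 L R \<longleftrightarrow>
      (\<forall>b c d. subseq [b, c, d] R \<longrightarrow> (\<forall>l \<in> set L. \<not> (b < d \<and> d < l \<and> l < c)))" for L R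
    by (auto simp: gap_132_def)
  then show ?thesis
    by (simp only: subseq3_map set_map ball_simps, intro all_cong1 imp_cong refl ball_cong)
      (simp add: strict_mono_on_nat_less[OF assms] subseq_mem3)
qed

lemma gap_21_map:
  assumes "strict_mono_on (set L \<union> set R) f"
  shows "gap_21 (map f L) (map f R) = gap_21 L R"
proof -
  have "gap_21 L R \<longleftrightarrow> (\<forall>c d. subseq [c, d] R \<longrightarrow> (\<forall>l \<in> set L. \<not> (d < l \<and> l < c)))" for L R
    by (auto simp: gap_21_def)
  then show ?thesis
    by (simp only: subseq2_map set_map ball_simps, intro all_cong1 imp_cong refl ball_cong)
      (simp add: strict_mono_on_nat_less[OF assms] subseq_mem2)
qed

lemma dominated_map:
  assumes "strict_mono_on (set L \<union> set R) f"
  shows "dominated (map f L) (map f R) = dominated L R"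
  by (auto simp: dominated_def strict_mono_on_nat_less[OF assms])

lemma min_first_map:
  assumes "strict_mono_on (set R) f" "R \<noteq> []"
  shows "min_first (map f R) = min_first R"
  using assms by (auto simp: min_first_def hd_map strict_mono_on_less_eq)

lemma avoids_213_subseq: "avoids_213 R \<Longrightarrow> subseq X R \<Longrightarrow> avoids_213 X"
  unfolding avoids_213_def by (meson subseq_order.trans)

lemma separated_mono:
  assumes "separated L R" "subseq L' L" "set R' \<subseteq> set R"
  shows "separated L' R'"
  unfolding separated_def
proof (intro allI impI)
  fix a b r assume "subseq [a, b] L' \<and> r \<in> set R'"
  then have "subseq [a, b] L" "r \<in> set R" using assms(2,3) subseq_order.trans by blast+
  with assms(1) show "\<not> (b < r \<and> r < a)" by (simp add: separated_def)
qed

lemma gap_132_mono: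
  assumes "gap_132 L R" "set L' \<subseteq> set L" "subseq R' R"
  shows "gap_132 L' R'"
  unfolding gap_132_def
proof (intro allI impI)
  fix b c d l assume "subseq [b, c, d] R' \<and> l \<in> set L'"
  then have "subseq [b, c, d] R" "l \<in> set L" using assms(2,3) subseq_order.trans by blast+
  with assms(1) show "\<not> (b < d \<and> d < l \<and> l < c)" by (simp add: gap_132_def)
qed

lemma gap_21_mono:
  assumes "gap_21 L R" "set L' \<subseteq> set L" "subseq R' R"
  shows "gap_21 L' R'"
  unfolding gap_21_def
proof (intro allI impI)
  fix c d l assume "subseq [c, d] R' \<and> l \<in> set L'"
  then have "subseq [c, d] R" "l \<in> set L" using assms(2,3) subseq_order.trans by blast+
  with assms(1) show "\<not> (d < l \<and> l < c)" by (simp add: gap_21_def)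
qed

lemma order_inv_indec: "order_inv indec_213"
  by (auto simp: order_inv_def indec_213_def avoids_213_map min_first_map)

context sum_closed
begin

lemma order_inv_U: "order_inv U"
  by (auto simp: order_inv_def U_def K_map)

lemma order_inv_U1: "order_inv U1"
  unfolding order_inv_def
proof (intro allI impI)
  fix f :: "nat \<Rightarrow> nat" and L R assume f: "strict_mono_on (set L \<union> set R) f"
  then have "K (map f L) = K L" by (intro K_map) (auto intro: monotone_on_subset)
  with f show "U1 (map f L) (map f R) = U1 L R"
    by (auto simp: U1_def map_eq_Cons_conv Cons_eq_map_conv strict_mono_on_nat_less[OF f])
qed

lemma order_inv_M: "order_inv M" and order_inv_Q: "order_inv Q"
  unfolding order_inv_def M_def Q_def
  by (auto simp: separated_map gap_132_map gap_21_map dominated_map avoids_213_map K_map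
    monotone_on_subset[of "set _ \<union> set _"])

lemma order_inv_T: "order_inv T"
  unfolding order_inv_def
proof (intro allI impI)
  fix f :: "nat \<Rightarrow> nat" and L R assume f: "strict_mono_on (set L \<union> set R) f"
  then have "strict_mono_on (set R) f" by (auto intro: monotone_on_subset)
  with f show "T (map f L) (map f R) = T L R"
    using order_inv_Q by (auto simp: T_def order_inv_def min_first_map)
qed

section \<open>Functional equations between the classes\<close>

lemma U1_eq: "gf U1 = fps_X * gf U"
proof (rule gf_remove_Max[where F = "\<lambda>m L R. (L, [m])"])
  fix m L R assume U1: "U1 L R" and m: "m \<in> set (L @ R)" "\<forall>y \<in> set (L @ R). y \<le> m"
    and d: "distinct (L @ R)"
  then obtain r where R: "R = [r]" and r: "\<forall>l \<in> set L. l < r" by (auto simp: U1_def)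
  have "m = r"
  proof (rule ccontr)
    assume "m \<noteq> r"
    then have "m < r" using m(1) R r by auto
    moreover have "r \<le> m" using m(2) R by simp
    ultimately show False by simp
  qed
  moreover have "set (L @ []) = set (L @ R) - {r}" using d R by auto
  moreover have "U L []" using U1 by (simp add: U_def U1_def)
  moreover have "distinct (L @ [])" using d by simp
  ultimately show "\<exists>L' R'. U L' R' \<and> (L, R) = (L', [m]) \<and>
      distinct (L' @ R') \<and> set (L' @ R') = set (L @ R) - {m}"
    using R by blast
qed (auto simp: U_def U1_def pairs_def)

text \<open>The minimum \<open>r\<close> of \<open>R\<close> stands first, so it plays no part in
  any 213 or 21 pattern of \<open>R\<close>, and the conditions of \<open>Q\<close> pass between
  \<open>r # R2\<close> and \<open>R2\<close>. By \<open>separated\<close>, \<open>L\<close> is cut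
  at \<open>r\<close>; the lower values are those up to \<open>hd R\<close>, which is what
  \<open>s\<close> reads off.\<close>

lemma T_eq: "gf T = fps_X * gf U * gf Q"
  unfolding U1_eq[symmetric]
proof (rule gf_split[where C = "(@)" and s = "\<lambda>L R. {x \<in> set L \<union> set R. x \<le> hd R}",
      OF order_inv_U1 order_inv_Q])
  fix L1 R1 L2 R2 :: "nat list"
  assume d: "distinct ((L1 @ R1) @ (L2 @ R2))" and "U1 L1 R1" and 2: "Q L2 R2"
    and lt: "\<forall>x \<in> set L1 \<union> set R1. \<forall>y \<in> set L2 \<union> set R2. x < y"
  then obtain r where K1: "K L1" and R1: "R1 = [r]" and r: "\<forall>l \<in> set L1. l < r"
    by (auto simp: U1_def)
  have lt': "\<And>x y. x \<in> set L1 \<Longrightarrow> y \<in> set L2 \<Longrightarrow> x < y" "\<And>x y. x \<in> set L1 \<Longrightarrow> y \<in> set R2 \<Longrightarrow> x < y"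
    "\<And>y. y \<in> set L2 \<Longrightarrow> r < y" "\<And>y. y \<in> set R2 \<Longrightarrow> r < y"
    using lt R1 by auto
  have "K (L1 @ L2)" using K1 2 lt by (simp add: K_append Q_def)
  moreover have "avoids_213 (r # R2)"
    unfolding avoids_213_def
  proof (intro allI impI notI, elim conjE)
    fix a b c assume "subseq [a, b, c] (r # R2)" and ba: "b < a" and ac: "a < c"
    then consider "a = r" "subseq [b, c] R2" | "subseq [a, b, c] R2"
      by (auto simp: subseq_Cons_iff)
    then show False
    proof cases
      case 1
      then show False using lt'(4)[of b] subseq_mem2[of b c] ba by auto
    next
      case 2
      then show False using 2 \<open>Q L2 R2\<close> ba ac by (simp add: Q_def avoids_213_def)
    qed
  qed
  moreover have "separated (L1 @ L2) (r # R2)"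
    unfolding separated_def
  proof (intro allI impI notI, elim conjE)
    fix a b x assume ab: "subseq [a, b] (L1 @ L2)" and x: "x \<in> set (r # R2)"
      and bx: "b < x" and xa: "x < a"
    from ab consider "a \<in> set L1" | "subseq [a, b] L2"
      by (auto simp: subseq2_append dest: subseq_mem2)
    then show False
    proof cases
      case 1
      then show False using x xa r lt'(2)[of a x] by auto
    next
      case 2
      then show False using x bx xa \<open>Q L2 R2\<close> lt'(3)[of b] subseq_mem2[OF 2]
        by (auto simp: Q_def separated_def)
    qed
  qed
  moreover have "gap_21 (L1 @ L2) (r # R2)"
    unfolding gap_21_def
  proof (intro allI impI notI, elim conjE)
    fix c d l assume cd: "subseq [c, d] (r # R2)" and l: "l \<in> set (L1 @ L2)"
      and dl: "d < l" and lc: "l < c"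
    from cd consider "c = r" "d \<in> set R2" | "subseq [c, d] R2"
      by (auto simp: subseq_Cons_iff subseq_singleton_left)
    then show False
    proof cases
      case 1
      then show False using lt'(4)[of d] dl lc by auto
    next
      case 2
      then show False using l dl lc \<open>Q L2 R2\<close> lt'(2)[of l d] subseq_mem2[OF 2]
        by (auto simp: Q_def gap_21_def)
    qed
  qed
  moreover have "dominated (L1 @ L2) (r # R2)" using 2 r by (auto simp: dominated_def Q_def)
  moreover have "min_first (r # R2)" using lt' by (auto simp: min_first_def less_imp_le)
  moreover have "{x \<in> set (L1 @ L2) \<union> set (R1 @ R2). x \<le> hd (R1 @ R2)} = set L1 \<union> set R1"
    using R1 r lt'(3,4) by (auto simp: less_imp_le not_le[symmetric])
  ultimately show "T (L1 @ L2) (R1 @ R2) \<and>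
      {x \<in> set (L1 @ L2) \<union> set (R1 @ R2). x \<le> hd (R1 @ R2)} = set L1 \<union> set R1"
    using R1 by (simp add: T_def Q_def)
next
  fix L R :: "nat list" assume d: "distinct (L @ R)" and T: "T L R"
  then obtain r B where R: "R = r # B" by (cases R) (auto simp: T_def)
  let ?L1 = "filter (\<lambda>x. x < r) L" and ?L2 = "filter (\<lambda>x. r < x) L"
  have L: "L = ?L1 @ ?L2"
    using T d R by (intro split_at_value) (auto simp: T_def Q_def separated_def)
  have B: "r < y" if "y \<in> set B" for y
    using that d T R by (force simp: T_def min_first_def le_less)
  have "K ?L1 \<and> K ?L2"
    using T L K_append[of ?L1 ?L2] by (auto simp: T_def Q_def)
  moreover have "Q ?L2 B"
    unfolding Q_def
  proof (intro conjI)
    have Q: "Q L R" using T by (simp add: T_def)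
    have B': "subseq B R" and L2': "subseq ?L2 L" by (simp_all add: R list_emb_Cons)
    show "K ?L2" using calculation by simp
    show "avoids_213 B" using Q B' by (auto simp: Q_def intro: avoids_213_subseq)
    have "set ?L2 \<subseteq> set L" "set B \<subseteq> set R" using R by auto
    then show "separated ?L2 B" "gap_21 ?L2 B"
      using Q L2' B' unfolding Q_def by (blast intro: separated_mono gap_21_mono)+
    show "dominated ?L2 B" unfolding dominated_def
    proof
      fix l assume "l \<in> set ?L2"
      then have l: "l \<in> set L" "r < l" by auto
      then obtain x where "x \<in> set R" "l < x" using Q by (auto simp: Q_def dominated_def)
      with l R show "\<exists>x \<in> set B. l < x" by auto
    qed
  qed
  ultimately have "U1 ?L1 [r] \<and> Q ?L2 B" by (simp add: U1_def)
  moreover have "\<forall>x \<in> set ?L1 \<union> set [r]. \<forall>y \<in> set ?L2 \<union> set B. x < y"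
  proof (intro ballI)
    fix x y assume "x \<in> set ?L1 \<union> set [r]" "y \<in> set ?L2 \<union> set B"
    then have "x \<le> r" "r < y" using B[of y] by auto
    then show "x < y" by (rule order.strict_trans1)
  qed
  ultimately show "\<exists>L1 R1 L2 R2. L = L1 @ L2 \<and> R = R1 @ R2 \<and> U1 L1 R1 \<and> Q L2 R2 \<and>
      (\<forall>x \<in> set L1 \<union> set R1. \<forall>y \<in> set L2 \<union> set R2. x < y)"
    using L R by (metis append_Cons append_Nil)
qed simp

text \<open>The decomposition is forced: the lower part is all of \<open>L\<close> and the upper
  part all of \<open>R\<close>.\<close>

lemma gf_U_indec: "gf (\<lambda>L R. Q L R \<and> R \<noteq> [] \<and> \<not> min_first R) = gf U * gf indec_213"
proof (rule gf_split[where C = "(@)" and s = "\<lambda>L R. set L", OF order_inv_U order_inv_indec])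
  fix L1 R1 L2 R2 :: "nat list"
  assume "U L1 R1" "indec_213 L2 R2"
    and "\<forall>x \<in> set L1 \<union> set R1. \<forall>y \<in> set L2 \<union> set R2. x < y"
  then have *: "R1 = []" "L2 = []" "K L1" "R2 \<noteq> []" "avoids_213 R2" "\<not> min_first R2"
    and lt: "\<And>l r. l \<in> set L1 \<Longrightarrow> r \<in> set R2 \<Longrightarrow> l < r"
    by (auto simp: U_def indec_213_def)
  have "separated L1 R2" unfolding separated_def
  proof (intro allI impI)
    fix a b r assume "subseq [a, b] L1 \<and> r \<in> set R2"
    then have "a < r" using lt[of a r] subseq_mem2(1)[of a b L1] by simp
    then show "\<not> (b < r \<and> r < a)" by simp
  qed
  moreover have "gap_21 L1 R2" unfolding gap_21_def
  proof (intro allI impI)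
    fix c d l assume "subseq [c, d] R2 \<and> l \<in> set L1"
    then have "l < d" using lt[of l d] subseq_mem2(2)[of c d R2] by simp
    then show "\<not> (d < l \<and> l < c)" by simp
  qed
  moreover have "dominated L1 R2" unfolding dominated_def
  proof
    fix l assume "l \<in> set L1"
    then have "l < hd R2" using lt *(4) by simp
    then show "\<exists>r \<in> set R2. l < r" using *(4) by (intro bexI[of _ "hd R2"]) simp_all
  qed
  ultimately show "(Q (L1 @ L2) (R1 @ R2) \<and> R1 @ R2 \<noteq> [] \<and> \<not> min_first (R1 @ R2)) \<and>
      set (L1 @ L2) = set L1 \<union> set R1"
    using * by (simp add: Q_def)
next
  fix L R :: "nat list" assume d: "distinct (L @ R)" and a: "Q L R \<and> R \<noteq> [] \<and> \<not> min_first R"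
  then have Q: "K L" "avoids_213 R" "gap_21 L R" "dominated L R" by (simp_all add: Q_def)
  obtain b B where R: "R = b # B" using a by (cases R) auto
  obtain m where m: "m \<in> set B" "m < b" using a R by (auto simp: min_first_def not_le)
  \<comment> \<open>Suppose \<open>r\<close> is below \<open>l\<close>. If the first entry
    \<open>b\<close> of \<open>R\<close> is above \<open>l\<close>, the descent from
    \<open>b\<close> to \<open>r\<close> straddles \<open>l\<close>. Otherwise take \<open>x\<close>
    above \<open>l\<close> from \<open>dominated\<close>, and \<open>m\<close> below
    \<open>b\<close>: either \<open>b, m, x\<close> is a 213, or the descent from \<open>x\<close>
    to \<open>m\<close> straddles \<open>l\<close>.\<close>
  have lt: "l < r" if l: "l \<in> set L" and r: "r \<in> set R" for l r
  proof (rule ccontr)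
    assume "\<not> l < r"
    have neq: "l \<noteq> x" if "x \<in> set R" for x using d l that by auto
    have gap: "\<not> (y < l \<and> l < x)" if "subseq [x, y] R" for x y
      using Q(3) that l by (simp add: gap_21_def)
    have av: "\<not> (y < x \<and> x < z)" if "subseq [x, y, z] R" for x y z
      using Q(2) that by (simp add: avoids_213_def)
    obtain x where x: "x \<in> set R" "l < x" using Q(4) l by (auto simp: dominated_def)
    have rl: "r < l" using \<open>\<not> l < r\<close> neq[OF r] by simp
    show False
    proof (cases "l < b")
      case True
      then have "r \<in> set B" using r R rl by auto
      then have "subseq [b, r] R" using R by (simp add: subseq_split)
      with gap rl True show False by blast
    next
      case False
      then have "b < l" using neq[of b] R by simp
      then have xB: "x \<in> set B" and "m \<noteq> x" using x R m by auto
      from subseq_pair_cases[OF m(1) xB \<open>m \<noteq> x\<close>] show False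
      proof
        assume "subseq [m, x] B"
        then have "subseq [b, m, x] R" using R by (simp add: subseq_Cons_iff)
        then show False using av m(2) \<open>b < l\<close> x(2) by fastforce
      next
        assume "subseq [x, m] B"
        then have "subseq [x, m] R" using R by (simp add: subseq_Cons_iff)
        then show False using gap m(2) \<open>b < l\<close> x(2) by fastforce
      qed
    qed
  qed
  have "U L []" "indec_213 [] R" using Q a by (simp_all add: U_def indec_213_def)
  moreover have "\<forall>x \<in> set L \<union> set []. \<forall>y \<in> set [] \<union> set R. x < y" using lt by simp
  moreover have "L = L @ []" "R = [] @ R" by simp_all
  ultimately show "\<exists>L1 R1 L2 R2. L = L1 @ L2 \<and> R = R1 @ R2 \<and> U L1 R1 \<and> indec_213 L2 R2 \<and>
      (\<forall>x \<in> set L1 \<union> set R1. \<forall>y \<in> set L2 \<union> set R2. x < y)"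
    by blast
qed simp

text \<open>The three terms: \<open>R\<close> is empty, which by \<open>dominated\<close> leaves
  only the empty pair; \<open>R\<close> starts with its minimum; or it does not.\<close>

lemma Q_eq: "gf Q = 1 + gf T + gf U * gf indec_213"
proof -
  have nil: "Q L R \<longleftrightarrow> L = []" if "R = []" for L R
    using that K_Nil
    by (auto simp: Q_def dominated_def avoids_213_def separated_def gap_21_def)
  have "gf Q = gf (\<lambda>L R. L = [] \<and> R = [] \<or> T L R) + gf U * gf indec_213"
    unfolding gf_U_indec[symmetric]
    by (rule gf_add) (use nil in \<open>auto simp: T_def\<close>)
  also have "gf (\<lambda>L R. L = [] \<and> R = [] \<or> T L R) = 1 + gf T"
    unfolding gf_Nil[symmetric] by (rule gf_add) (auto simp: T_def)
  finally show ?thesis .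
qed

text \<open>The lower part supplies the tail of \<open>R\<close> that starts at its minimum, so
  \<open>C\<close> puts the lower list second. \<open>s\<close> drops the entries before the minimum
  and bounds the lower values by the maximum of what remains.\<close>

lemma T_mul_M: "gf (\<lambda>L R. M L R \<and> R \<noteq> []) = gf T * gf M"
proof (rule gf_split[where C = "\<lambda>R1 R2. R2 @ R1" and
    s = "\<lambda>L R. {x \<in> set L \<union> set R. x \<le> Max (set (dropWhile (\<lambda>y. y \<noteq> Min (set R)) R))}",
    OF order_inv_T order_inv_M])
  fix L1 R1 L2 R2 :: "nat list"
  assume d: "distinct ((L1 @ R1) @ (L2 @ R2))" and T: "T L1 R1" and M: "M L2 R2"
    and lt0: "\<forall>x \<in> set L1 \<union> set R1. \<forall>y \<in> set L2 \<union> set R2. x < y"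
  have lt: "\<And>x y. x \<in> set L1 \<Longrightarrow> y \<in> set L2 \<Longrightarrow> x < y" "\<And>x y. x \<in> set L1 \<Longrightarrow> y \<in> set R2 \<Longrightarrow> x < y"
    "\<And>x y. x \<in> set R1 \<Longrightarrow> y \<in> set L2 \<Longrightarrow> x < y" "\<And>x y. x \<in> set R1 \<Longrightarrow> y \<in> set R2 \<Longrightarrow> x < y"
    using lt0 by auto
  have Ts: "K L1" "avoids_213 R1" "separated L1 R1" "gap_21 L1 R1" "dominated L1 R1"
    "R1 \<noteq> []" "min_first R1" using T by (simp_all add: T_def Q_def)
  have Ms: "K L2" "avoids_213 R2" "separated L2 R2" "gap_132 L2 R2"
    using M by (simp_all add: M_def)
  have "K (L1 @ L2)" using Ts(1) Ms(1) lt by (simp add: K_append)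
  moreover have "avoids_213 (R2 @ R1)"
    unfolding avoids_213_def
  proof (intro allI impI notI, elim conjE)
    fix a b c assume "subseq [a, b, c] (R2 @ R1)" and ba: "b < a" and ac: "a < c"
    then consider "subseq [a, b, c] R2" | "a \<in> set R2" "c \<in> set R1" | "subseq [a, b, c] R1"
      by (auto simp: subseq3_append dest: subseq_mem2)
    then show False
    proof cases
      case 1 then show False using Ms(2) ba ac by (simp add: avoids_213_def)
    next
      case 2 then show False using lt(4)[of c a] ac by simp
    next
      case 3 then show False using Ts(2) ba ac by (simp add: avoids_213_def)
    qed
  qed
  moreover have "separated (L1 @ L2) (R2 @ R1)"
    unfolding separated_def
  proof (intro allI impI notI, elim conjE)
    fix a b x assume ab: "subseq [a, b] (L1 @ L2)" and x: "x \<in> set (R2 @ R1)"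
      and bx: "b < x" and xa: "x < a"
    from ab consider "subseq [a, b] L1" | "a \<in> set L1" "b \<in> set L2" | "subseq [a, b] L2"
      by (auto simp: subseq2_append)
    then show False
    proof cases
      case 1
      then show False using x bx xa Ts(3) lt(2)[of a x] subseq_mem2[OF 1]
        by (auto simp: separated_def)
    next
      case 2 then show False using lt(1)[of a b] bx xa by simp
    next
      case 3
      then show False using x bx xa Ms(3) lt(3)[of x b] subseq_mem2[OF 3]
        by (auto simp: separated_def)
    qed
  qed
  moreover have "gap_132 (L1 @ L2) (R2 @ R1)"
    unfolding gap_132_def
  proof (intro allI impI notI, elim conjE)
    fix b c e l assume bce: "subseq [b, c, e] (R2 @ R1)" and l: "l \<in> set (L1 @ L2)"
      and ord: "b < e" "e < l" "l < c"
    from bce consider "subseq [b, c, e] R2" | "b \<in> set R2" "e \<in> set R1" | "subseq [b, c, e] R1"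
      by (auto simp: subseq3_append dest: subseq_mem2)
    then show False
    proof cases
      case 1
      then show False using l ord Ms(4) lt(2)[of l e] subseq_mem3[OF 1]
        by (auto simp: gap_132_def)
    next
      case 2 then show False using lt(4)[of e b] ord by simp
    next
      case 3
      then show False using l ord Ts(4) lt(3)[of c l] subseq_mem3[OF 3]
        by (auto simp: gap_21_def)
    qed
  qed
  moreover have "{x \<in> set (L1 @ L2) \<union> set (R2 @ R1).
      x \<le> Max (set (dropWhile (\<lambda>y. y \<noteq> Min (set (R2 @ R1))) (R2 @ R1)))} = set L1 \<union> set R1"
  proof -
    have hd: "hd R1 \<in> set R1" using Ts(6) by simp
    have min: "Min (set (R2 @ R1)) = hd R1"
    proof (rule Min_eqI)
      fix y assume "y \<in> set (R2 @ R1)"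
      then show "hd R1 \<le> y" using Ts(7) lt(4)[OF hd] by (auto simp: min_first_def less_imp_le)
    qed (use hd in simp_all)
    have "hd R1 \<notin> set R2" using d hd by auto
    then have "dropWhile (\<lambda>y. y \<noteq> hd R1) (R2 @ R1) = dropWhile (\<lambda>y. y \<noteq> hd R1) R1"
      by (intro dropWhile_append2) auto
    also have "\<dots> = R1" using Ts(6) by (cases R1) auto
    finally have drop: "dropWhile (\<lambda>y. y \<noteq> Min (set (R2 @ R1))) (R2 @ R1) = R1"
      by (simp only: min)
    have ne: "set R1 \<noteq> {}" using Ts(6) by simp
    \<comment> \<open>By \<open>dominated\<close> the largest value of the lower part lies in
      \<open>R1\<close>.\<close>
    have up: "x \<le> Max (set R1)" if "x \<in> set L1 \<union> set R1" for x
      using that Ts(5) unfolding dominated_def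
      by (metis List.finite_set Max_ge Un_iff less_imp_le order.trans)
    have dn: "\<not> x \<le> Max (set R1)" if "x \<in> set L2 \<union> set R2" for x
      using that Max_in[OF _ ne] lt(3,4)[of "Max (set R1)" x] by (auto simp: not_le)
    show ?thesis unfolding drop using up dn by fastforce
  qed
  ultimately show "(M (L1 @ L2) (R2 @ R1) \<and> R2 @ R1 \<noteq> []) \<and>
      {x \<in> set (L1 @ L2) \<union> set (R2 @ R1).
        x \<le> Max (set (dropWhile (\<lambda>y. y \<noteq> Min (set (R2 @ R1))) (R2 @ R1)))} = set L1 \<union> set R1"
    using Ts(6) by (simp add: M_def)
next
  fix L R :: "nat list" assume d: "distinct (L @ R)" and MR: "M L R \<and> R \<noteq> []"
  then have Ms: "K L" "avoids_213 R" "separated L R" "gap_132 L R" by (simp_all add: M_def)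
  define r where "r = Min (set R)"
  have "r \<in> set R" using MR unfolding r_def by (intro Min_in) auto
  then obtain A B where R: "R = A @ r # B" by (meson split_list)
  have r_le: "r \<le> x" if "x \<in> set R" for x using that unfolding r_def by simp
  have r_less: "r < x" if "x \<in> set A \<union> set B" for x
    using that r_le[of x] d R by (auto simp: le_less)
  \<comment> \<open>\<open>v\<close> becomes the largest lower value, so it is the threshold at
    which \<open>L\<close> is cut.\<close>
  define v where "v = Max (set (r # B))"
  have v: "v \<in> set (r # B)" unfolding v_def by (intro Max_in) auto
  have v_ge: "x \<le> v" if "x \<in> set (r # B)" for x using that unfolding v_def by (intro Max_ge) auto
  \<comment> \<open>An entry \<open>a\<close> of \<open>A\<close> below \<open>v\<close> would make
    \<open>a, r, v\<close> a 213.\<close>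
  have v_less: "v < a" if a: "a \<in> set A" for a
  proof (rule ccontr)
    assume "\<not> v < a"
    moreover have "a \<noteq> v" using a v d R by auto
    ultimately have "a < v" by simp
    moreover have "r < a" using r_less a by simp
    ultimately have "v \<noteq> r" by simp
    then have "v \<in> set B" using v by simp
    then have "subseq [a, r, v] R" using a R by (simp add: subseq_split)
    with Ms(2) \<open>a < v\<close> \<open>r < a\<close> show False by (auto simp: avoids_213_def)
  qed
  have vR: "v \<in> set R" and vL: "v \<notin> set L" using v R d by auto
  let ?L1 = "filter (\<lambda>x. x < v) L" and ?L2 = "filter (\<lambda>x. v < x) L"
  have L: "L = ?L1 @ ?L2"
    using Ms(3) vR vL by (intro split_at_value) (auto simp: separated_def)
  have sub: "subseq ?L1 L" "subseq ?L2 L" by simp_all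
  have subR: "subseq A R" "subseq (r # B) R" by (simp_all add: R subseq_drop_many subseq_rev_drop_many)
  have sets: "set ?L1 \<subseteq> set L" "set ?L2 \<subseteq> set L" "set A \<subseteq> set R" "set (r # B) \<subseteq> set R"
    using R by auto
  have K: "K ?L1 \<and> K ?L2" using Ms(1) L K_append[of ?L1 ?L2] by auto
  \<comment> \<open>Here \<open>gap_132\<close> turns into the stronger \<open>gap_21\<close>: a
    descent straddling \<open>l\<close> cannot involve \<open>r\<close>, so \<open>r\<close> in
    front of it completes a 132.\<close>
  have gap: "gap_21 ?L1 (r # B)"
    unfolding gap_21_def
  proof (intro allI impI notI, elim conjE)
    fix c e l assume ce: "subseq [c, e] (r # B)" and l: "l \<in> set ?L1" and el: "e < l" and lc: "l < c"
    have "e \<in> set R" using subseq_mem2[OF ce] sets(4) by blast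
    then have "r \<le> e" by (rule r_le)
    with el lc ce have "subseq [c, e] B" by (auto simp: subseq_Cons_iff)
    then have "r < e" "subseq [r, c, e] R"
      using r_less[of e] subseq_mem2[of c e B] R by (auto simp: subseq_split)
    then show False using Ms(4) l el lc by (auto simp: gap_132_def)
  qed
  have "T ?L1 (r # B)"
    unfolding T_def Q_def
  proof (intro conjI gap)
    show "K ?L1" using K by simp
    show "avoids_213 (r # B)" by (rule avoids_213_subseq[OF Ms(2) subR(2)])
    show "separated ?L1 (r # B)" by (rule separated_mono[OF Ms(3) sub(1) sets(4)])
    show "dominated ?L1 (r # B)" using v by (auto simp: dominated_def)
    show "min_first (r # B)" using r_less by (auto simp: min_first_def less_imp_le)
  qed simp
  moreover have "M ?L2 A"
    unfolding M_def using K avoids_213_subseq[OF Ms(2) subR(1)]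
      separated_mono[OF Ms(3) sub(2) sets(3)] gap_132_mono[OF Ms(4) sets(2) subR(1)] by simp
  moreover have "\<forall>x \<in> set ?L1 \<union> set (r # B). \<forall>y \<in> set ?L2 \<union> set A. x < y"
  proof (intro ballI)
    fix x y assume xy: "x \<in> set ?L1 \<union> set (r # B)" "y \<in> set ?L2 \<union> set A"
    from xy(1) have "x \<le> v" using v_ge[of x] by auto
    also from xy(2) have "v < y" using v_less by auto
    finally show "x < y" .
  qed
  ultimately show "\<exists>L1 R1 L2 R2. L = L1 @ L2 \<and> R = R2 @ R1 \<and> T L1 R1 \<and> M L2 R2 \<and>
      (\<forall>x \<in> set L1 \<union> set R1. \<forall>y \<in> set L2 \<union> set R2. x < y)"
    using L R by blast
qed simp

lemma M_eq: "gf M = gf U + gf T * gf M"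
  unfolding T_mul_M[symmetric]
proof (rule gf_add)
  fix L R :: "nat list"
  have "M L [] = U L []" by (simp add: M_def U_def avoids_213_def separated_def gap_132_def)
  then show "M L R = (U L R \<or> M L R \<and> R \<noteq> [])" by (cases R) (simp_all add: U_def)
qed (simp add: U_def)

end

section \<open>Counting 213-avoiders and eliminating \<open>i\<close>\<close>

interpretation trivial: sum_closed "\<lambda>L. L = []"
  by unfold_locales auto

text \<open>With \<open>L\<close> empty the conditions linking \<open>L\<close> and \<open>R\<close>
  hold vacuously, so \<open>Q\<close> and \<open>M\<close> coincide and the general equations
  collapse to the Catalan equation for \<open>c\<close> and a linear formula for
  \<open>i\<close>.\<close>

lemma gf_indec_213:
  defines "c \<equiv> gf trivial.M" and "i \<equiv> gf indec_213"
  shows "c = 1 + fps_X * c\<^sup>2" and "i = (1 - fps_X) * c - 1"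
proof -
  have U: "gf trivial.U = 1"
    unfolding gf_Nil[symmetric] by (rule gf_cong) (auto simp: trivial.U_def)
  have "trivial.Q L R = trivial.M L R" for L R
    by (cases L) (simp_all add: trivial.M_def trivial.Q_def separated_def gap_132_def
      gap_21_def dominated_def)
  then have QM: "gf trivial.Q = c" unfolding c_def by (intro gf_cong)
  have T: "gf trivial.T = fps_X * c" using trivial.T_eq by (simp add: U QM)
  show "c = 1 + fps_X * c\<^sup>2"
    using trivial.M_eq by (simp add: U T power2_eq_square mult.assoc flip: c_def)
  show "i = (1 - fps_X) * c - 1"
    using trivial.Q_eq by (simp add: U T QM algebra_simps flip: i_def)
qed

text \<open>With \<open>f = x * h\<close>, the expression \<open>k\<close> equals
  \<open>x * u\<^sup>2 * f * i\<close> but does not mention \<open>i\<close>. The quadratic equation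
  for \<open>i\<close>, multiplied by \<open>x * u ^ 4 * f\<^sup>2\<close>, therefore becomes a
  relation between \<open>x\<close>, \<open>u\<close> and \<open>h\<close> alone.\<close>

lemma (in sum_closed) gf_M_algebraic:
  defines "h \<equiv> gf M" and "u \<equiv> gf U"
  defines "k \<equiv> fps_X * h * (1 - 2 * fps_X * u) - fps_X * u * (1 - fps_X * u)"
  shows "k\<^sup>2 = (1 - 3 * fps_X) * u\<^sup>2 * (fps_X * h) * k - fps_X ^ 3 * u ^ 4 * (fps_X * h)\<^sup>2"
proof -
  define x :: "int fps" where "x = fps_X"
  define c where "c = gf trivial.M"
  define i where "i = gf indec_213"
  define f where "f = x * h"
  have c: "c = 1 + x * c\<^sup>2" and i: "i = (1 - x) * c - 1"
    using gf_indec_213 by (simp_all add: c_def i_def x_def)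
  \<comment> \<open>The Catalan equation rewritten for \<open>i\<close>, by expressing both
    \<open>i\<close> and \<open>x * c\<^sup>2\<close> linearly in \<open>c\<close>.\<close>
  have "x * i\<^sup>2 = (1 - x)\<^sup>2 * (x * c\<^sup>2) - 2 * x * (1 - x) * c + x"
    by (simp add: i algebra_simps power2_eq_square)
  also have "x * c\<^sup>2 = c - 1" using c by (simp add: algebra_simps)
  finally have i2: "x * i\<^sup>2 = (1 - 3 * x) * i - x\<^sup>2"
    by (simp add: i algebra_simps power2_eq_square)
  define t q where "t = gf T" and "q = gf Q"
  have t: "t = x * u * q" and q: "q = 1 + t + u * i" and h: "h = u + t * h"
    using T_eq Q_eq M_eq by (simp_all add: t_def q_def x_def u_def i_def h_def)
  have tx: "t * (1 - x * u) = x * u * (1 + u * i)"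
  proof -
    have "t = x * u * (1 + t + u * i)" using t q by simp
    then show ?thesis by (simp add: algebra_simps)
  qed
  have "f * (1 - t) = x * (h - t * h)" by (simp add: f_def algebra_simps)
  also have "h - t * h = u" using h by (metis add_diff_cancel_right')
  finally have "f * (1 - t) = x * u" .
  \<comment> \<open>Multiplying by \<open>1 - x * u\<close> makes \<open>t\<close> appear only in
    the product that \<open>tx\<close> evaluates.\<close>
  then have "f * ((1 - x * u) - t * (1 - x * u)) = x * u * (1 - x * u)"
    by (metis (no_types, lifting) left_diff_distrib mult.assoc mult_1)
  then have k: "k = x * u\<^sup>2 * f * i"
    unfolding tx by (simp add: k_def f_def x_def algebra_simps power2_eq_square)
  have "k\<^sup>2 = x * u ^ 4 * f\<^sup>2 * (x * i\<^sup>2)"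
    by (simp add: k power2_eq_square power4_eq_xxxx mult_ac)
  also have "\<dots> = (1 - 3 * x) * u\<^sup>2 * f * (x * u\<^sup>2 * f * i) - x ^ 3 * u ^ 4 * f\<^sup>2"
    unfolding i2 by (simp add: algebra_simps power2_eq_square power3_eq_cube power4_eq_xxxx)
  finally show ?thesis by (simp add: k f_def x_def)
qed

section \<open>Avoidance of 4213 and 3142, and its structure around the maximum\<close>

definition avoids_both :: "nat list \<Rightarrow> bool" where
  "avoids_both p \<longleftrightarrow> (\<forall>a b c d. subseq [a, b, c, d] p \<longrightarrow>
     \<not> (c < b \<and> b < d \<and> d < a) \<and> \<not> (b < d \<and> d < a \<and> a < c))"

lemma contains_pattern_iff_subseq:
  "contains_pattern p s \<longleftrightarrow> (\<exists>u. subseq u p \<and> order_iso u s)"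
proof
  assume "\<exists>u. subseq u p \<and> order_iso u s"
  then obtain I where "order_iso (nths p I) s" by (auto simp: subseq_conv_nths)
  \<comment> \<open>The index set obtained from \<open>subseq\<close> may exceed the list; indices
    beyond its length select nothing.\<close>
  moreover have "nths p I = nths p (I \<inter> {..<length p})"
    unfolding nths_def
    by (rule arg_cong[of _ _ "map fst"], rule filter_cong) (auto simp: set_zip)
  ultimately show "contains_pattern p s"
    unfolding contains_pattern_def by (intro exI[of _ "I \<inter> {..<length p}"]) simp
qed (auto simp: contains_pattern_def subseq_conv_nths)

lemma order_iso_4213:
  "order_iso u [4, 2, 1, 3] \<longleftrightarrow> (\<exists>a b c d. u = [a, b, c, d] \<and> c < b \<and> b < d \<and> d < a)"
proof -
  have "length u = 4 \<longleftrightarrow> (\<exists>a b c d. u = [a, b, c, d])"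
    by (auto simp: numeral_eq_Suc length_Suc_conv)
  moreover have "order_iso [a, b, c, d] [4, 2, 1, 3] \<longleftrightarrow> c < b \<and> b < d \<and> d < a" for a b c d
    unfolding order_iso_def by (auto simp: numeral_eq_Suc All_less_Suc)
  moreover have "length u = 4" if "order_iso u [4, 2, 1, 3]"
    using that by (simp add: order_iso_def)
  ultimately show ?thesis by metis
qed

lemma order_iso_3142:
  "order_iso u [3, 1, 4, 2] \<longleftrightarrow> (\<exists>a b c d. u = [a, b, c, d] \<and> b < d \<and> d < a \<and> a < c)"
proof -
  have "length u = 4 \<longleftrightarrow> (\<exists>a b c d. u = [a, b, c, d])"
    by (auto simp: numeral_eq_Suc length_Suc_conv)
  moreover have "order_iso [a, b, c, d] [3, 1, 4, 2] \<longleftrightarrow> b < d \<and> d < a \<and> a < c" for a b c d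
    unfolding order_iso_def by (auto simp: numeral_eq_Suc All_less_Suc)
  moreover have "length u = 4" if "order_iso u [3, 1, 4, 2]"
    using that by (simp add: order_iso_def)
  ultimately show ?thesis by metis
qed

lemma avoids_both_iff: "avoids p [4, 2, 1, 3] \<and> avoids p [3, 1, 4, 2] \<longleftrightarrow> avoids_both p"
  unfolding avoids_def contains_pattern_iff_subseq order_iso_4213 order_iso_3142 avoids_both_def
  by blast

lemma avoids_both_subseq: "avoids_both p \<Longrightarrow> subseq q p \<Longrightarrow> avoids_both q"
  unfolding avoids_both_def using subseq_order.trans by blast

text \<open>In both patterns the first entry exceeds the last. An occurrence straddling
  \<open>X\<close> and \<open>Y\<close> would start in \<open>X\<close> and end in \<open>Y\<close>,
  hence have its first entry below its last.\<close>

interpretation both: sum_closed avoids_both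
proof
  show "avoids_both []" by (simp add: avoids_both_def)
  show "avoids_both (map f X) = avoids_both X" if "strict_mono_on (set X) f" for f X
    unfolding avoids_both_def subseq4_map
    by (intro all_cong1 imp_cong refl)
      (simp add: strict_mono_on_nat_less[OF that] subseq_mem4)
  fix X Y :: "nat list" assume lt: "\<forall>x \<in> set X. \<forall>y \<in> set Y. x < y"
  show "avoids_both (X @ Y) \<longleftrightarrow> avoids_both X \<and> avoids_both Y"
  proof
    assume "avoids_both (X @ Y)"
    then show "avoids_both X \<and> avoids_both Y"
      by (auto elim: avoids_both_subseq simp: subseq_drop_many subseq_rev_drop_many)
  next
    assume *: "avoids_both X \<and> avoids_both Y"
    show "avoids_both (X @ Y)"
      unfolding avoids_both_def
    proof (intro allI impI)
      fix a b c d assume "subseq [a, b, c, d] (X @ Y)"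
      then consider "subseq [a, b, c, d] X" | "subseq [a, b, c, d] Y"
        | "a \<in> set X" "b \<in> set X" "c \<in> set X" "d \<in> set Y"
        | "a \<in> set X" "b \<in> set X" "c \<in> set Y" "d \<in> set Y"
        | "a \<in> set X" "b \<in> set Y" "c \<in> set Y" "d \<in> set Y"
        by (auto simp: subseq4_append dest: subseq_mem2 subseq_mem3)
      then show "\<not> (c < b \<and> b < d \<and> d < a) \<and> \<not> (b < d \<and> d < a \<and> a < c)"
      proof cases
        case 1 then show ?thesis using * unfolding avoids_both_def by blast
      next
        case 2 then show ?thesis using * unfolding avoids_both_def by blast
      next
        case 3 then show ?thesis using lt by force
      next
        case 4 then show ?thesis using lt by force
      next
        case 5 then show ?thesis using lt by force
      qed
    qed
  qed
qed

text \<open>From left to right, each violation is completed to a forbidden pattern: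
  \<open>m, a, b, c\<close> is a 4213, while \<open>a, b, m, r\<close> and \<open>l, b, c, d\<close>
  are 3142.\<close>

lemma avoids_both_insert_Max:
  assumes m: "\<forall>y \<in> set L \<union> set R. y < m"
  shows "avoids_both (L @ m # R) \<longleftrightarrow> both.M L R"
proof
  assume A: "avoids_both (L @ m # R)"
  then have av: "\<not> (c < b \<and> b < d \<and> d < a) \<and> \<not> (b < d \<and> d < a \<and> a < c)"
    if "subseq [a, b, c, d] (L @ m # R)" for a b c d
    using that unfolding avoids_both_def by blast
  have "avoids_both L" by (rule avoids_both_subseq[OF A]) (simp add: subseq_rev_drop_many)
  moreover have "avoids_213 R"
    unfolding avoids_213_def
  proof (intro allI impI notI, elim conjE)
    fix a b c assume s: "subseq [a, b, c] R" and o: "b < a" "a < c"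
    then have "subseq [m, a, b, c] (L @ m # R)"
      by (auto simp: subseq4_append subseq_Cons_iff)
    then show False using av m o subseq_mem3(3)[OF s] by blast
  qed
  moreover have "separated L R"
    unfolding separated_def
  proof (intro allI impI notI, elim conjE)
    fix a b r assume s: "subseq [a, b] L" and r: "r \<in> set R" and o: "b < r" "r < a"
    then have "subseq [a, b, m, r] (L @ m # R)"
      by (auto simp: subseq4_append subseq_Cons_iff subseq_singleton_left)
    then show False using av m o subseq_mem2(1)[OF s] by blast
  qed
  moreover have "gap_132 L R"
    unfolding gap_132_def
  proof (intro allI impI notI, elim conjE)
    fix b c d l assume s: "subseq [b, c, d] R" and l: "l \<in> set L" and o: "b < d" "d < l" "l < c"
    then have "subseq [l, b, c, d] (L @ m # R)"
      by (auto simp: subseq4_append subseq_Cons_iff)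
    then show False using av o by blast
  qed
  ultimately show "both.M L R" by (simp add: both.M_def)
next
  assume "both.M L R"
  then have L: "avoids_both L" and R: "avoids_213 R" and sep: "separated L R" and gap: "gap_132 L R"
    by (simp_all add: both.M_def)
  show "avoids_both (L @ m # R)"
    unfolding avoids_both_def
  proof (intro allI impI)
    fix a b c d assume s: "subseq [a, b, c, d] (L @ m # R)"
    have R': "\<not> (y < x \<and> x < z)" if "subseq [x, y, z] R" for x y z
      using R that by (simp add: avoids_213_def)
    have sep': "\<not> (y < r \<and> r < x)" if "subseq [x, y] L" "r \<in> set R" for x y r
      using sep that by (simp add: separated_def)
    have "a \<in> set (L @ m # R)" "b \<in> set (L @ m # R)" "c \<in> set (L @ m # R)" "d \<in> set (L @ m # R)"
      by (rule subseq_mem4[OF s])+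
    then have le: "a \<le> m" "b \<le> m" "c \<le> m" "d \<le> m" using m by (auto simp: less_imp_le)
    \<comment> \<open>Neither pattern has its maximum in second or last place. In both, the last
      value lies between the second and the first, which \<open>separated\<close> excludes if
      \<open>a, b\<close> lie in \<open>L\<close> and \<open>d\<close> in \<open>R\<close>. If
      \<open>b, c, d\<close> lie in \<open>R\<close>, 4213 leaves a 213 there, and 3142 leaves a 132
      whose gap contains \<open>a\<close>. Inside \<open>R\<close>, both patterns contain
      213.\<close>
    from s consider "subseq [a, b, c, d] L" | "subseq [a, b] L" "d = m" | "d \<in> set R" "subseq [a, b] L"
      | "a \<in> set L" "b = m" | "subseq [b, c, d] R" "a \<in> set L" | "a = m" "subseq [b, c, d] R"
      | "subseq [a, b, c, d] R"
      by (auto simp: subseq4_append subseq_Cons_iff subseq_singleton_left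
          dest: subseq_mem2 subseq_mem3)
    then show "\<not> (c < b \<and> b < d \<and> d < a) \<and> \<not> (b < d \<and> d < a \<and> a < c)"
    proof cases
      case 1 then show ?thesis using L unfolding avoids_both_def by blast
    next
      case 2 then show ?thesis using le by auto
    next
      case 3 then show ?thesis using sep'[of a b d] by auto
    next
      case 4 then show ?thesis using le by auto
    next
      case 5 then show ?thesis using R'[of b c d] gap by (auto simp: gap_132_def)
    next
      case 6 then show ?thesis using R'[of b c d] le by auto
    next
      case 7
      then show ?thesis using R'[of b c d] R'[of a b c] subseq_mem4[OF 7] by auto
    qed
  qed
qed

section \<open>The counted permutations and the sextic equation\<close>

lemma gf_U_both: "gf both.U = 1 + av_gf"
proof (rule fps_ext)
  fix n
  have "pairs both.U S = (\<lambda>p. (p, [])) ` {p \<in> permutations_of_set S.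
      avoids p [4, 2, 1, 3] \<and> avoids p [3, 1, 4, 2]}" for S
    unfolding avoids_both_iff by (auto simp: pairs_def both.U_def permutations_of_set_def)
  then have "card (pairs both.U {1..n}) = av_count n"
    unfolding av_count_def by (simp add: card_image inj_on_def)
  \<comment> \<open>\<open>av_count\<close> uses the values from 1 to \<open>n\<close>,
    \<open>gf\<close> those below \<open>n\<close>; order invariance identifies the counts.\<close>
  then have "int (av_count n) = gf both.U $ n"
    using card_pairs[OF both.order_inv_U, of "{1..n}"] by simp
  \<comment> \<open>The empty permutation, which \<open>av_gf\<close> omits, accounts for the
    summand 1.\<close>
  moreover have "gf both.U $ 0 = 1"
  proof -
    have "pairs both.U {} = {([], [])}" using both.K_Nil by (auto simp: pairs_def both.U_def)
    then show ?thesis by (simp add: gf_def)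
  qed
  ultimately show "gf both.U $ n = (1 + av_gf) $ n" by (simp add: av_gf_def)
qed

text \<open>Nonempty avoiders are viewed as pairs with empty second list. Deleting the maximum from
  \<open>L @ m # R\<close> leaves exactly a pair of class \<open>M\<close>.\<close>

lemma av_gf_eq: "av_gf = fps_X * gf both.M"
proof -
  let ?N = "\<lambda>L R. R = [] \<and> L \<noteq> [] \<and> avoids_both L"
  have "gf both.U = 1 + gf ?N"
    unfolding gf_Nil[symmetric] by (rule gf_add) (use both.K_Nil in \<open>auto simp: both.U_def\<close>)
  then have "av_gf = gf ?N" using gf_U_both by simp
  also have "gf ?N = fps_X * gf both.M"
  proof (rule gf_remove_Max[where F = "\<lambda>m L R. (L @ m # R, [])"])
    fix m L R L' R'
    assume "m \<notin> set (L @ R)" "m \<notin> set (L' @ R')" "(L @ m # R, []) = (L' @ m # R', [])"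
    then show "(L, R) = (L', R')" by (auto simp: append_Cons_eq_iff)
  next
    fix m L R assume d: "distinct (L @ R)" "both.M L R" and m: "\<forall>y \<in> set (L @ R). y < m"
    then have "avoids_both (L @ m # R)" by (subst avoids_both_insert_Max) auto
    then show "(L @ m # R, []) \<in> pairs ?N (insert m (set (L @ R)))"
      using d m by (auto simp: pairs_def)
  next
    fix m L R assume d: "distinct (L @ R)" and N: "R = [] \<and> L \<noteq> [] \<and> avoids_both L"
      and m: "m \<in> set (L @ R)" and le: "\<forall>y \<in> set (L @ R). y \<le> m"
    then obtain A B where L: "L = A @ m # B" using split_list[of m L] by auto
    have "\<forall>y \<in> set A \<union> set B. y < m" using d le L by (auto simp: le_less)
    then have "both.M A B" using N unfolding L by (simp add: avoids_both_insert_Max)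
    moreover have "distinct (A @ B)" "set (A @ B) = set (L @ R) - {m}" using d L N by auto
    ultimately show "\<exists>L' R'. both.M L' R' \<and> (L, R) = (L' @ m # R', []) \<and>
        distinct (L' @ R') \<and> set (L' @ R') = set (L @ R) - {m}"
      using L N by blast
  qed simp
  finally show ?thesis .
qed

theorem theorem2p1:
  fixes f x :: "int fps"
  assumes "f = av_gf" and "x = fps_X"
  shows "x^3 * f^6 + (7*x^3 - 7*x^2 + 2*x) * f^5
       + (x^4 + 14*x^3 - 21*x^2 + 10*x - 1) * f^4
       + (4*x^4 + 8*x^3 - 19*x^2 + 11*x - 2) * f^3
       + (6*x^4 - 5*x^3 - 2*x^2 + 2*x) * f^2
       + (4*x^4 - 7*x^3 + 4*x^2 - x) * f
       + x^4 - 2*x^3 + x^2 = 0"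
proof -
  \<comment> \<open>The \<open>k\<close> of \<open>gf_M_algebraic\<close> after substituting
    \<open>1 + f\<close> for \<open>u\<close> and \<open>f\<close> for
    \<open>fps_X * h\<close>.\<close>
  define k where "k = f * (1 - 2 * x * (1 + f)) - x * (1 + f) * (1 - x * (1 + f))"
  have "k\<^sup>2 = (1 - 3 * x) * (1 + f)\<^sup>2 * f * k - x ^ 3 * (1 + f) ^ 4 * f\<^sup>2"
    using both.gf_M_algebraic
    unfolding k_def assms gf_U_both av_gf_eq[symmetric] by simp
  \<comment> \<open>Expanded and collected by powers of \<open>f\<close>, the relation for
    \<open>k\<close> is the sextic.\<close>
  then show ?thesis unfolding k_def by algebra
qed

end
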